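(* Let $m$ be a positive integer and let $S$ be a numerical semigroup with multiplicity $m$. Then there exist finitely many $m$-irreducible numerical semigroups $S_1, \ldots, S_k$ (with $k \ge 1$) such that $S = S_1 \cap \cdots \cap S_k$.
   Context: $\mathbb{N}$ denotes the set of nonnegative integers. A numerical semigroup is a subset $S \subseteq \mathbb{N}$ closed under addition, containing $0$, and such that $\mathbb{N}\setminus S$ is finite. The multiplicity of $S$ is the least positive integer belonging to $S$. For a positive integer $m$, $\mathcal{S}(m)$ denotes the set of numerical semigroups with multiplicity $m$. An element $S \in \mathcal{S}(m)$ is $m$-irreducible if it cannot be expressed as the intersection of two elements of $\mathcal{S}(m)$ each containing $S$ properly. *)

theory Defs
  imports Main
begin

definition numerical_semigroup :: "nat set \<Rightarrow> bool" where
  "numerical_semigroup S \<longleftrightarrow>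
     0 \<in> S \<and> (\<forall>x\<in>S. \<forall>y\<in>S. x + y \<in> S) \<and> finite (UNIV - S)"

(* The least element exists whenever S is a numerical semigroup, because S is then infinite. *)
definition semigroup_multiplicity :: "nat set \<Rightarrow> nat" where
  "semigroup_multiplicity S = (LEAST x. 0 < x \<and> x \<in> S)"

definition numerical_semigroups_of_mult :: "nat \<Rightarrow> nat set set" where
  "numerical_semigroups_of_mult m =
     {S. numerical_semigroup S \<and> semigroup_multiplicity S = m}"

definition m_irreducible :: "nat \<Rightarrow> nat set \<Rightarrow> bool" where
  "m_irreducible m S \<longleftrightarrow>
     S \<in> numerical_semigroups_of_mult m \<and>
     \<not> (\<exists>A\<in>numerical_semigroups_of_mult m. \<exists>B\<in>numerical_semigroups_of_mult m.
          S \<subset> A \<and> S \<subset> B \<and> S = A \<inter> B)"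

end

theory Submission
  imports Defs
begin

text \<open>Induction on the number of gaps, i.e. the size of the finite complement of
  \<open>S\<close>. If \<open>S\<close> is not m-irreducible, it is \<open>A \<inter> B\<close> for
  two strictly larger semigroups of the same multiplicity; each has fewer gaps, so each already
  decomposes, and the two families together decompose \<open>S\<close>.
  \<open>finite_m_irreducible_decomposition\<close> carries this argument with a set of semigroups,
  so that families merge by union; \<open>proposition1\<close> only numbers that set.\<close>

lemma finite_m_irreducible_decomposition:
  assumes "S \<in> numerical_semigroups_of_mult m"
  shows "\<exists>F. finite F \<and> F \<noteq> {} \<and> (\<forall>T\<in>F. m_irreducible m T) \<and> S = \<Inter>F"
  using assms
proof (induction "card (UNIV - S)" arbitrary: S rule: less_induct)
  case less
  show ?case
  proof (cases "m_irreducible m S")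
    case True
    then show ?thesis by (intro exI[of _ "{S}"]) auto
  next
    case False
    with less.prems obtain A B where
      A: "A \<in> numerical_semigroups_of_mult m" "S \<subset> A" and
      B: "B \<in> numerical_semigroups_of_mult m" "S \<subset> B" and
      eq: "S = A \<inter> B"
      unfolding m_irreducible_def by blast
    have fin: "finite (UNIV - S)"
      using less.prems by (simp add: numerical_semigroups_of_mult_def numerical_semigroup_def)
    \<comment> \<open>Enlarging \<open>S\<close> strictly shrinks its set of gaps; finiteness of
      that set makes the cardinality drop strictly.\<close>
    have smaller: "card (UNIV - X) < card (UNIV - S)" if "S \<subset> X" for X
      using that by (intro psubset_card_mono[OF fin]) blast
    obtain F where F: "finite F" "F \<noteq> {}" "\<forall>T\<in>F. m_irreducible m T" "A = \<Inter>F"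
      using less.hyps[OF smaller[OF A(2)] A(1)] by blast
    obtain G where G: "finite G" "\<forall>T\<in>G. m_irreducible m T" "B = \<Inter>G"
      using less.hyps[OF smaller[OF B(2)] B(1)] by blast
    show ?thesis
      \<comment> \<open>The intersection over \<open>F \<union> G\<close> is
        \<open>A \<inter> B\<close>, and \<open>F\<close> alone makes the union nonempty.\<close>
      using F G eq by (intro exI[of _ "F \<union> G"]) auto
  qed
qed

theorem proposition1:
  fixes m :: nat and S :: "nat set"
  assumes "0 < m"
    and "S \<in> numerical_semigroups_of_mult m"
  shows "\<exists>(k::nat) (T :: nat \<Rightarrow> nat set).
           1 \<le> k \<and> (\<forall>i\<in>{1..k}. m_irreducible m (T i)) \<and> S = (\<Inter>i\<in>{1..k}. T i)"
proof -
  obtain F where F: "finite F" "F \<noteq> {}" "\<forall>T\<in>F. m_irreducible m T" "S = \<Inter>F"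
    using finite_m_irreducible_decomposition[OF assms(2)] by blast
  obtain T where T: "bij_betw T {1..card F} F"
    using ex_bij_betw_nat_finite_1[OF F(1)] by blast
  then have image: "T ` {1..card F} = F"
    by (rule bij_betw_imp_surj_on)
  \<comment> \<open>Nonemptiness of \<open>F\<close>, kept through the induction, is what gives at
    least one component.\<close>
  have "1 \<le> card F"
    using F(1,2) by (simp add: Suc_le_eq card_gt_0_iff)
  moreover have "\<forall>i\<in>{1..card F}. m_irreducible m (T i)"
    using F(3) image by blast
  moreover have "S = (\<Inter>i\<in>{1..card F}. T i)"
    using F(4) image by simp
  ultimately show ?thesis by blast
qed

end
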